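(* Let $f\in\mathbb{Z}[x]$ be a monic irreducible polynomial of degree $n\ge 2$. Let $r_1,\dots,r_n$ be the Euclidean ($L^2$) norms of the rows of $M_f$ and $c_1,\dots,c_n$ the Euclidean norms of its columns, with $r_{\min}=\min_i r_i$ and $c_{\min}=\min_i c_i$. Then \[ \operatorname{SD}(f)\le\left(\frac{n}{n-1}\right)^{(n-1)/2}|\det M_f|^{\frac{1-n}{n}}\min\left\{\frac{\prod_{i=1}^n r_i}{r_{\min}},\ \frac{\prod_{i=1}^n c_i}{c_{\min}}\right\}. \]
   Context: For a monic irreducible polynomial $f\in\mathbb{Z}[x]$ of degree $n$ with complex roots $\alpha_1,\dots,\alpha_n$, $M_f$ denotes the $n\times n$ Vandermonde matrix with $(i,j)$ entry $\alpha_i^{\,j-1}$. The spectral distortion of $f$ is $\operatorname{SD}(f)=\dfrac{|\det M_f|^{1/n}}{\sigma_{\min}(M_f)}$, where $\sigma_{\min}(M_f)$ is the smallest singular value of $M_f$. *)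

theory Defs
  imports
    "Jordan_Normal_Form.Schur_Decomposition"
    "Jordan_Normal_Form.Spectral_Radius"
    "HOL-Analysis.L2_Norm"
    "HOL-Computational_Algebra.Polynomial_Factorial"
begin

definition root_enumeration :: "int poly \<Rightarrow> complex list \<Rightarrow> bool" where
  "root_enumeration f as \<longleftrightarrow> mset as = proots (map_poly complex_of_int f)"

definition vandermonde_mat :: "complex list \<Rightarrow> complex mat" where
  "vandermonde_mat as = mat (length as) (length as) (\<lambda>(i, j). (as ! i) ^ j)"

(* For a square matrix, these are the singular values
   (a matrix with more columns than rows would get a spurious value 0). *)
definition singular_values :: "complex mat \<Rightarrow> real set" where
  "singular_values A = {s. 0 \<le> s \<and> eigenvalue (mat_adjoint A * A) (complex_of_real (s\<^sup>2))}"

definition sigma_min :: "complex mat \<Rightarrow> real" where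
  "sigma_min A = Min (singular_values A)"

(* M_f is determined by f only up to the order of its rows; the value does not depend on that
   order, see spectral_distortion_eq below. *)
definition spectral_distortion :: "int poly \<Rightarrow> real" where
  "spectral_distortion f =
    (let M = vandermonde_mat (SOME as. root_enumeration f as)
     in cmod (det M) powr (1 / real (degree f)) / sigma_min M)"

lemma root_enumeration_length: "root_enumeration f as \<Longrightarrow> length as = degree f"
proof -
  assume "root_enumeration f as"
  then have "length as = size (proots (map_poly complex_of_int f))"
    unfolding root_enumeration_def using size_mset[of as] by simp
  also have "\<dots> = degree (map_poly complex_of_int f)" by (rule size_proots_complex)
  also have "\<dots> = degree f" by (rule of_int_hom.degree_map_poly_hom)
  finally show ?thesis .
qed

lemma root_enumeration_exists: "\<exists>as. root_enumeration f as"
  unfolding root_enumeration_def by (rule ex_mset)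

lemma mat_adjoint_carrier: "A \<in> carrier_mat n m \<Longrightarrow> mat_adjoint A \<in> carrier_mat m n"
  by (auto simp: mat_adjoint_def)

lemma mat_adjoint_index:
  "A \<in> carrier_mat n m \<Longrightarrow> i < m \<Longrightarrow> j < n \<Longrightarrow> mat_adjoint A $$ (i, j) = conjugate (A $$ (j, i))"
  by (auto simp: mat_adjoint_def mat_of_rows_index)

lemma vandermonde_mat_carrier: "vandermonde_mat as \<in> carrier_mat (length as) (length as)"
  by (simp add: vandermonde_mat_def)

lemma vandermonde_gram:
  "mat_adjoint (vandermonde_mat as) * vandermonde_mat as =
    mat (length as) (length as) (\<lambda>(j, k). \<Sum>a\<in>#mset as. cnj a ^ j * a ^ k)"
proof (rule eq_matI)
  fix j k
  assume jk: "j < dim_row (mat (length as) (length as) (\<lambda>(j, k). \<Sum>a\<in>#mset as. cnj a ^ j * a ^ k))"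
    "k < dim_col (mat (length as) (length as) (\<lambda>(j, k). \<Sum>a\<in>#mset as. cnj a ^ j * a ^ k))"
  note C = vandermonde_mat_carrier[of as] and D = mat_adjoint_carrier[OF vandermonde_mat_carrier[of as]]
  have "(mat_adjoint (vandermonde_mat as) * vandermonde_mat as) $$ (j, k) =
      (\<Sum>i<length as. mat_adjoint (vandermonde_mat as) $$ (j, i) * vandermonde_mat as $$ (i, k))"
    using C D jk by (simp add: scalar_prod_def atLeast0LessThan)
  also have "\<dots> = (\<Sum>i<length as. cnj (as ! i) ^ j * (as ! i) ^ k)"
    using jk by (intro sum.cong) (simp_all add: mat_adjoint_index[OF C], simp add: vandermonde_mat_def)
  also have "\<dots> = (\<Sum>a\<leftarrow>as. cnj a ^ j * a ^ k)"
    by (simp add: sum_list_sum_nth atLeast0LessThan)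
  also have "\<dots> = (\<Sum>a\<in>#mset as. cnj a ^ j * a ^ k)"
    by (simp flip: sum_mset_sum_list)
  finally show "(mat_adjoint (vandermonde_mat as) * vandermonde_mat as) $$ (j, k) =
      mat (length as) (length as) (\<lambda>(j, k). \<Sum>a\<in>#mset as. cnj a ^ j * a ^ k) $$ (j, k)"
    using jk by simp
qed (use mat_adjoint_carrier[OF vandermonde_mat_carrier[of as]] vandermonde_mat_carrier[of as] in auto)

lemma cmod_det_sq:
  assumes A: "A \<in> carrier_mat n n"
  shows "complex_of_real ((cmod (det A))\<^sup>2) = det (mat_adjoint A * A)"
proof -
  interpret cnj: comm_ring_hom cnj by unfold_locales auto
  have adj: "mat_adjoint A = map_mat cnj (transpose_mat A)"
    using A mat_adjoint_carrier[OF A] by (intro eq_matI) (auto simp: mat_adjoint_index[OF A])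
  have "det (mat_adjoint A) = cnj (det A)"
    unfolding adj cnj.hom_det using det_transpose[OF A] by simp
  then show ?thesis
    using det_mult[OF mat_adjoint_carrier[OF A] A] complex_norm_square[of "det A"]
    by (simp add: mult.commute)
qed

lemma singular_values_finite:
  assumes A: "A \<in> carrier_mat n n"
  shows "finite (singular_values A)"
proof -
  have G: "mat_adjoint A * A \<in> carrier_mat n n"
    using mat_adjoint_carrier[OF A] A by simp
  have "inj_on (\<lambda>s. complex_of_real (s\<^sup>2)) (singular_values A)"
    by (auto simp: inj_on_def singular_values_def simp del: of_real_power)
  moreover have "(\<lambda>s. complex_of_real (s\<^sup>2)) ` singular_values A \<subseteq> spectrum (mat_adjoint A * A)"
    by (auto simp: singular_values_def spectrum_def)
  ultimately show ?thesis
    using finite_imageD[OF finite_subset[OF _ card_finite_spectrum(1)[OF G]]] by blast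
qed

lemma gram_eigenvalue_nonneg:
  assumes A: "A \<in> carrier_mat n n" and ev: "eigenvalue (mat_adjoint A * A) k"
  shows "\<exists>s\<ge>0. k = complex_of_real (s\<^sup>2)"
proof -
  have B: "mat_adjoint A \<in> carrier_mat n n" by (rule mat_adjoint_carrier[OF A])
  have G: "mat_adjoint A * A \<in> carrier_mat n n" using A B by simp
  obtain v where v: "v \<in> carrier_vec n" "v \<noteq> 0\<^sub>v n" "(mat_adjoint A * A) *\<^sub>v v = k \<cdot>\<^sub>v v"
    using ev G unfolding eigenvalue_def eigenvector_def by auto
  define w where "w = A *\<^sub>v v"
  have w: "w \<in> carrier_vec n" using A v by (simp add: w_def)
  define P where "P = (\<Sum>i<n. (cmod (v $ i))\<^sup>2)"
  define Q where "Q = (\<Sum>i<n. (cmod (w $ i))\<^sup>2)"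
  have Bw: "mat_adjoint A *\<^sub>v w = k \<cdot>\<^sub>v v"
    using v assoc_mult_mat_vec[OF B A v(1)] by (simp add: w_def)
  have norm: "complex_of_real ((cmod z)\<^sup>2) = cnj z * z" for z
    using complex_norm_square[of z] by (simp add: mult.commute)
  have wi: "w $ i = (\<Sum>j<n. A $$ (i, j) * v $ j)" if "i < n" for i
    using that A v(1) by (simp add: w_def scalar_prod_def atLeast0LessThan)
  have Bwj: "k * v $ j = (\<Sum>i<n. cnj (A $$ (i, j)) * w $ i)" if "j < n" for j
  proof -
    have "k * v $ j = (mat_adjoint A *\<^sub>v w) $ j" using that v(1) by (simp add: Bw)
    also have "\<dots> = (\<Sum>i<n. mat_adjoint A $$ (j, i) * w $ i)"
      using that B w by (simp add: scalar_prod_def atLeast0LessThan)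
    also have "\<dots> = (\<Sum>i<n. cnj (A $$ (i, j)) * w $ i)"
      using that by (intro sum.cong) (simp_all add: mat_adjoint_index[OF A])
    finally show ?thesis .
  qed
  have "k * complex_of_real P = (\<Sum>j<n. cnj (v $ j) * (k * v $ j))"
    unfolding P_def of_real_sum norm by (simp add: sum_distrib_left algebra_simps)
  also have "\<dots> = (\<Sum>j<n. \<Sum>i<n. cnj (v $ j) * (cnj (A $$ (i, j)) * w $ i))"
    by (intro sum.cong) (simp_all add: Bwj sum_distrib_left)
  also have "\<dots> = (\<Sum>i<n. \<Sum>j<n. cnj (v $ j) * (cnj (A $$ (i, j)) * w $ i))"
    by (rule sum.swap)
  also have "\<dots> = (\<Sum>i<n. cnj (\<Sum>j<n. A $$ (i, j) * v $ j) * w $ i)"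
    by (simp add: sum_distrib_right mult.assoc mult.left_commute)
  also have "\<dots> = complex_of_real Q"
    unfolding Q_def of_real_sum norm by (intro sum.cong) (simp_all add: wi)
  finally have eq: "k * complex_of_real P = complex_of_real Q" .
  have "\<exists>i<n. v $ i \<noteq> 0"
  proof (rule ccontr)
    assume "\<not> (\<exists>i<n. v $ i \<noteq> 0)"
    then have "v = 0\<^sub>v n" using v(1) by (intro eq_vecI) auto
    with v(2) show False ..
  qed
  then obtain i where i: "i < n" "v $ i \<noteq> 0" by blast
  have "0 < (cmod (v $ i))\<^sup>2" using i by simp
  also have "\<dots> \<le> P" unfolding P_def using i by (intro member_le_sum) auto
  finally have P: "0 < P" .
  have Q: "0 \<le> Q" unfolding Q_def by (intro sum_nonneg) auto
  have "k = complex_of_real (Q / P)" using eq P by (simp add: field_simps)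
  moreover have "(sqrt (Q / P))\<^sup>2 = Q / P" using P Q by simp
  ultimately show ?thesis using P Q by (intro exI[of _ "sqrt (Q / P)"]) simp
qed

lemma singular_values_nonempty:
  assumes A: "A \<in> carrier_mat n n" and n: "0 < n"
  shows "singular_values A \<noteq> {}"
proof -
  have "mat_adjoint A * A \<in> carrier_mat n n"
    using mat_adjoint_carrier[OF A] A by simp
  from spectrum_non_empty[OF this n] obtain k where "eigenvalue (mat_adjoint A * A) k"
    by (auto simp: spectrum_def)
  with gram_eigenvalue_nonneg[OF A] show ?thesis
    unfolding singular_values_def by blast
qed

lemma spectral_distortion_eq:
  assumes as: "root_enumeration f as"
  shows "spectral_distortion f =
    cmod (det (vandermonde_mat as)) powr (1 / real (degree f)) / sigma_min (vandermonde_mat as)"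
proof -
  define bs where "bs = (SOME as. root_enumeration f as)"
  have bs: "root_enumeration f bs"
    unfolding bs_def by (rule someI_ex[OF root_enumeration_exists])
  have "mset as = mset bs" using as bs by (simp add: root_enumeration_def)
  then have G: "mat_adjoint (vandermonde_mat as) * vandermonde_mat as =
      mat_adjoint (vandermonde_mat bs) * vandermonde_mat bs"
    unfolding vandermonde_gram using mset_eq_length[of as bs] by simp
  then have "complex_of_real ((cmod (det (vandermonde_mat as)))\<^sup>2) =
      complex_of_real ((cmod (det (vandermonde_mat bs)))\<^sup>2)"
    by (simp only: cmod_det_sq[OF vandermonde_mat_carrier])
  then have "cmod (det (vandermonde_mat as)) = cmod (det (vandermonde_mat bs))"
    by (simp del: of_real_power)
  then show ?thesis
    using G unfolding spectral_distortion_def Let_def bs_def[symmetric] sigma_min_def singular_values_def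
    by simp
qed

end

theory Submission
  imports Defs "HOL-Analysis.Convex"
begin

text \<open>Let \<open>A\<close> be invertible, \<open>s\<close> its smallest singular value, \<open>v\<close> a unit vector with \<open>|A v| = s\<close>, and \<open>B\<close>
  the matrix \<open>A\<close> with its rows scaled to unit length. Then \<open>|B v| \<le> s / r\<^sub>m\<^sub>i\<^sub>n\<close> and
  \<open>|det A| = |det B| \<Prod> r\<^sub>i\<close>. Let \<open>U\<close> be unitary with first column \<open>v\<close>. Then
  \<open>B U\<close> has squared Frobenius norm \<open>n\<close> and first column \<open>B v\<close>. Multiply that column by \<open>t\<close> with
  \<open>t\<^sup>2 |B v|\<^sup>2 = n / (n - 1)\<close>. The squared Frobenius norm becomes at most \<open>n + n / (n - 1) = n\<^sup>2 / (n - 1)\<close>, so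
  AM-GM for the squared singular values gives \<open>t\<^sup>2 |det B|\<^sup>2 \<le> (n / (n - 1))\<^sup>n\<close>, which is the bound
  with row norms. The adjoint has the same singular values, which gives the bound with column norms. If
  \<open>det A = 0\<close>, both sides of the theorem are 0.\<close>

section \<open>Adjoints of complex matrices\<close>

lemma complex_of_real_cmod_square: "complex_of_real ((cmod z)\<^sup>2) = cnj z * z"
  using complex_norm_square[of z] by (simp add: mult.commute)

lemma index_mult_mat_sum:
  assumes "A \<in> carrier_mat n m" "B \<in> carrier_mat m k" "i < n" "j < k"
  shows "(A * B) $$ (i, j) = (\<Sum>l<m. A $$ (i, l) * B $$ (l, j))"
  using assms by (auto simp: scalar_prod_def atLeast0LessThan intro!: sum.cong)

lemma mat_adjoint_adjoint:
  fixes A :: "complex mat"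
  assumes "A \<in> carrier_mat n m"
  shows "mat_adjoint (mat_adjoint A) = A"
  using assms mat_adjoint_carrier[OF assms] mat_adjoint_carrier[OF mat_adjoint_carrier[OF assms]]
  by (intro eq_matI)
    (auto simp: mat_adjoint_index[OF mat_adjoint_carrier[OF assms]] mat_adjoint_index[OF assms])

lemma mat_adjoint_mult:
  fixes A B :: "complex mat"
  assumes A: "A \<in> carrier_mat n m" and B: "B \<in> carrier_mat m k"
  shows "mat_adjoint (A * B) = mat_adjoint B * mat_adjoint A"
proof -
  have AB: "A * B \<in> carrier_mat n k" using A B by simp
  note c = mat_adjoint_carrier[OF A] mat_adjoint_carrier[OF B] mat_adjoint_carrier[OF AB]
  show ?thesis
  proof (rule eq_matI)
    fix i j
    assume "i < dim_row (mat_adjoint B * mat_adjoint A)" "j < dim_col (mat_adjoint B * mat_adjoint A)"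
    then have ij: "i < k" "j < n" using c by auto
    have "mat_adjoint (A * B) $$ (i, j) = (\<Sum>l<m. cnj (A $$ (j, l)) * cnj (B $$ (l, i)))"
      by (simp add: mat_adjoint_index[OF AB ij] index_mult_mat_sum[OF A B ij(2,1)] del: index_mult_mat)
    also have "\<dots> = (mat_adjoint B * mat_adjoint A) $$ (i, j)"
      unfolding index_mult_mat_sum[OF c(2,1) ij]
      by (intro sum.cong) (simp_all add: mat_adjoint_index[OF A] mat_adjoint_index[OF B] ij mult.commute)
    finally show "mat_adjoint (A * B) $$ (i, j) = (mat_adjoint B * mat_adjoint A) $$ (i, j)" .
  qed (use c in auto)
qed

text \<open>The two Gram matrices \<open>A * mat_adjoint A\<close> and
  \<open>mat_adjoint A * A\<close> have equal determinants because \<open>det\<close> is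
  multiplicative.\<close>

lemma cmod_det_adjoint:
  assumes A: "A \<in> carrier_mat n n"
  shows "cmod (det (mat_adjoint A)) = cmod (det A)"
proof -
  note B = mat_adjoint_carrier[OF A]
  have "complex_of_real ((cmod (det (mat_adjoint A)))\<^sup>2) = det (A * mat_adjoint A)"
    using cmod_det_sq[OF B] by (simp add: mat_adjoint_adjoint[OF A])
  also have "\<dots> = det (mat_adjoint A * A)"
    using det_mult[OF A B] det_mult[OF B A] by (simp add: mult.commute)
  also have "\<dots> = complex_of_real ((cmod (det A))\<^sup>2)"
    by (rule cmod_det_sq[OF A, symmetric])
  finally show ?thesis by (simp del: of_real_power)
qed

section \<open>Trace and determinant of the Gram matrix, and the AM-GM bound\<close>

lemma sum_diag_mult_commute:
  fixes A B :: "'a :: comm_ring_1 mat"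
  assumes A: "A \<in> carrier_mat n m" and B: "B \<in> carrier_mat m n"
  shows "(\<Sum>i<n. (A * B) $$ (i, i)) = (\<Sum>j<m. (B * A) $$ (j, j))"
proof -
  have "(\<Sum>i<n. (A * B) $$ (i, i)) = (\<Sum>i<n. \<Sum>j<m. A $$ (i, j) * B $$ (j, i))"
    by (intro sum.cong) (simp_all add: index_mult_mat_sum[OF A B] del: index_mult_mat)
  also have "\<dots> = (\<Sum>j<m. \<Sum>i<n. B $$ (j, i) * A $$ (i, j))"
    by (subst sum.swap) (simp add: mult.commute)
  also have "\<dots> = (\<Sum>j<m. (B * A) $$ (j, j))"
    by (intro sum.cong) (simp_all add: index_mult_mat_sum[OF B A] del: index_mult_mat)
  finally show ?thesis .
qed

lemma gram_diag:
  assumes A: "A \<in> carrier_mat n m" and j: "j < m"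
  shows "(mat_adjoint A * A) $$ (j, j) = complex_of_real (\<Sum>i<n. (cmod (A $$ (i, j)))\<^sup>2)"
  unfolding index_mult_mat_sum[OF mat_adjoint_carrier[OF A] A j j] of_real_sum
  by (intro sum.cong) (simp_all add: mat_adjoint_index[OF A j] complex_of_real_cmod_square del: of_real_power)

text \<open>The \<open>x i\<close> are the squared singular values with multiplicity, which the set
  \<open>singular_values A\<close> does not record. They are read off the diagonal of a Schur form
  of the Gram matrix: their product is its determinant, their sum its trace.\<close>

lemma gram_spectrum:
  assumes A: "A \<in> carrier_mat n n"
  obtains x :: "nat \<Rightarrow> real"
  where "\<And>i. i < n \<Longrightarrow> 0 \<le> x i" "(\<Prod>i<n. x i) = (cmod (det A))\<^sup>2"
    "(\<Sum>i<n. x i) = (\<Sum>i<n. \<Sum>j<n. (cmod (A $$ (i, j)))\<^sup>2)"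
proof -
  define G where "G = mat_adjoint A * A"
  have G: "G \<in> carrier_mat n n" using mat_adjoint_carrier[OF A] A by (simp add: G_def)
  obtain es where es: "char_poly G = (\<Prod>a\<leftarrow>es. [:- a, 1:])" "length es = n"
    using char_poly_factorized[OF G] by blast
  obtain T P Q where T: "schur_decomposition G es = (T, P, Q)"
    by (cases "schur_decomposition G es") auto
  from schur_decomposition[OF G es(1) T]
  have sim: "similar_mat_wit G T P Q" and ut: "upper_triangular T" and diag: "diag_mat T = es" by auto
  note s = similar_mat_witD2[OF G sim]
  have "\<exists>y\<ge>0. T $$ (i, i) = complex_of_real y" if "i < n" for i
  proof -
    \<comment> \<open>Diagonal entries of \<open>T\<close> are roots of the characteristic
      polynomial, hence eigenvalues of a Gram matrix, which are real and nonnegative.\<close>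
    have "T $$ (i, i) \<in> set es" using that s(5) by (auto simp: diag[symmetric] diag_mat_def)
    then have "poly (char_poly G) (T $$ (i, i)) = 0"
      unfolding es by (auto simp: poly_prod_list prod_list_zero_iff)
    then have "eigenvalue G (T $$ (i, i))" by (simp add: eigenvalue_root_char_poly[OF G])
    from gram_eigenvalue_nonneg[OF A this[unfolded G_def]] show ?thesis by (metis zero_le_power2)
  qed
  then obtain x where x: "\<And>i. i < n \<Longrightarrow> 0 \<le> x i" "\<And>i. i < n \<Longrightarrow> T $$ (i, i) = complex_of_real (x i)"
    by metis
  have "complex_of_real (\<Prod>i<n. x i) = (\<Prod>i<n. T $$ (i, i))" by (simp add: x(2))
  also have "\<dots> = det T"
    using det_upper_triangular[OF ut s(5)] s(5) by (simp add: prod_list_diag_prod atLeast0LessThan)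
  also have "\<dots> = det G" using sim det_similar[of G T] unfolding similar_mat_def by metis
  also have "\<dots> = complex_of_real ((cmod (det A))\<^sup>2)" using cmod_det_sq[OF A] by (simp add: G_def)
  finally have p: "(\<Prod>i<n. x i) = (cmod (det A))\<^sup>2" by (simp only: of_real_eq_iff)
  have "complex_of_real (\<Sum>i<n. x i) = (\<Sum>i<n. T $$ (i, i))" by (simp add: x(2))
  \<comment> \<open>Since \<open>Q * P\<close> is the identity and \<open>G = P * T * Q\<close>,
    moving \<open>P\<close> to the front under the trace turns tr T into tr G.\<close>
  also have "\<dots> = (\<Sum>i<n. (T * Q * P) $$ (i, i))"
    using s by (simp add: assoc_mult_mat[of T n n Q n P n])
  also have "\<dots> = (\<Sum>i<n. (P * (T * Q)) $$ (i, i))"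
    by (rule sum_diag_mult_commute) (use s in auto)
  also have "P * (T * Q) = G" using s by (simp add: assoc_mult_mat[of P n n T n Q n])
  also have "(\<Sum>i<n. G $$ (i, i)) = complex_of_real (\<Sum>j<n. \<Sum>i<n. (cmod (A $$ (i, j)))\<^sup>2)"
    unfolding G_def of_real_sum[of _ "{..<n}"] by (intro sum.cong refl gram_diag[OF A, unfolded of_real_sum]) simp
  finally have "(\<Sum>i<n. x i) = (\<Sum>j<n. \<Sum>i<n. (cmod (A $$ (i, j)))\<^sup>2)" by (simp only: of_real_eq_iff)
  then have "(\<Sum>i<n. x i) = (\<Sum>i<n. \<Sum>j<n. (cmod (A $$ (i, j)))\<^sup>2)" by (subst sum.swap)
  with x p that show ?thesis by blast
qed

text \<open>AM-GM for the squared singular values, raised to the power \<open>n\<close>.\<close>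

lemma cmod_det_sq_le_frobenius:
  assumes A: "A \<in> carrier_mat n n" and n: "0 < n"
  shows "(cmod (det A))\<^sup>2 \<le> ((\<Sum>i<n. \<Sum>j<n. (cmod (A $$ (i, j)))\<^sup>2) / n) ^ n"
proof -
  obtain x :: "nat \<Rightarrow> real" where x: "\<And>i. i < n \<Longrightarrow> 0 \<le> x i"
    and p: "(\<Prod>i<n. x i) = (cmod (det A))\<^sup>2"
    and s: "(\<Sum>i<n. x i) = (\<Sum>i<n. \<Sum>j<n. (cmod (A $$ (i, j)))\<^sup>2)"
    using gram_spectrum[OF A] by metis
  have p0: "0 \<le> (\<Prod>i<n. x i)" using x by (intro prod_nonneg) auto
  have "(\<Prod>i<n. x i) powr (1 / card {..<n}) \<le> (\<Sum>i<n. x i / card {..<n})"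
    by (rule arith_geom_mean) (use x n in auto)
  then have "((\<Prod>i<n. x i) powr (1 / n)) ^ n \<le> ((\<Sum>i<n. x i) / n) ^ n"
    by (intro power_mono) (auto simp: sum_divide_distrib)
  moreover have "((\<Prod>i<n. x i) powr (1 / n)) ^ n = (\<Prod>i<n. x i)"
    using p0 n by (simp add: real_root_pow_pos2 flip: root_powr_inverse)
  ultimately show ?thesis by (simp add: p s)
qed

section \<open>Unitary matrices\<close>

lemma unitary_completion:
  fixes v :: "complex vec"
  assumes v: "v \<in> carrier_vec n" and unit: "(\<Sum>i<n. (cmod (v $ i))\<^sup>2) = 1"
  obtains U where "U \<in> carrier_mat n n" "mat_adjoint U * U = 1\<^sub>m n" "\<And>i. i < n \<Longrightarrow> U $$ (i, 0) = v $ i"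
proof -
  have v0: "v \<noteq> 0\<^sub>v n" using unit by auto
  have n0: "0 < n" using unit by (cases n) auto
  interpret cof_vec_space n "TYPE(complex)" .
  define b where "b = basis_completion v"
  \<comment> \<open>Gram-Schmidt keeps the first vector of the completed basis, so
    \<open>ws ! 0\<close> is \<open>v\<close>. As \<open>v\<close> has norm 1, the normalisation of
    the columns in \<open>U\<close> leaves it unchanged too.\<close>
  define ws where "ws = gram_schmidt n b"
  note bc = basis_completion[OF v v0, folded b_def]
  from bc(6,7) n0 obtain vs where bv: "b = v # vs" by (cases b) auto
  have ws: "set ws \<subseteq> carrier_vec n" "corthogonal ws" "length ws = n"
    using gram_schmidt_result[OF bc(2,4,5) ws_def] bc(6) by auto
  have "hd ws = v" using gram_schmidt_hd[OF v, of vs, folded bv] by (simp add: ws_def)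
  then have ws0: "ws ! 0 = v" using ws(3) n0 by (subst hd_conv_nth[symmetric]) auto
  have wc: "ws ! i \<in> carrier_vec n" if "i < n" for i using ws(1,3) that by auto
  define N where "N i = (\<Sum>k<n. (cmod (ws ! i $ k))\<^sup>2)" for i
  have sp: "ws ! i \<bullet>c ws ! j = (\<Sum>k<n. ws ! i $ k * cnj (ws ! j $ k))" if "i < n" "j < n" for i j
    using wc[OF that(1)] wc[OF that(2)] by (auto simp: scalar_prod_def atLeast0LessThan intro!: sum.cong)
  have orth: "(\<Sum>k<n. cnj (ws ! i $ k) * ws ! j $ k) = (if i = j then complex_of_real (N i) else 0)"
    if ij: "i < n" "j < n" for i j
  proof -
    have "(\<Sum>k<n. cnj (ws ! i $ k) * ws ! j $ k) = ws ! j \<bullet>c ws ! i"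
      using sp[OF ij(2,1)] by (simp add: mult.commute)
    moreover have "i = j \<Longrightarrow> (\<Sum>k<n. cnj (ws ! i $ k) * ws ! j $ k) = complex_of_real (N i)"
      unfolding N_def of_real_sum complex_of_real_cmod_square by simp
    ultimately show ?thesis using corthogonalD[OF ws(2)] ij ws(3) by auto
  qed
  have Npos: "0 < N i" if i: "i < n" for i
  proof -
    \<comment> \<open>\<open>corthogonal\<close> says that the product of two members vanishes
      exactly when their indices differ, so it also excludes zero vectors.\<close>
    have "ws ! i \<bullet>c ws ! i \<noteq> 0" using corthogonalD[OF ws(2)] i ws(3) by auto
    then have "N i \<noteq> 0" using orth[OF i i] sp[OF i i] by (simp add: mult.commute)
    moreover have "0 \<le> N i" by (simp add: N_def sum_nonneg)
    ultimately show ?thesis by simp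
  qed
  define U where "U = mat n n (\<lambda>(i, j). ws ! j $ i / complex_of_real (sqrt (N j)))"
  have U: "U \<in> carrier_mat n n" by (simp add: U_def)
  have "mat_adjoint U * U = 1\<^sub>m n"
  proof (rule eq_matI)
    fix i j assume "i < dim_row (1\<^sub>m n :: complex mat)" "j < dim_col (1\<^sub>m n :: complex mat)"
    then have ij: "i < n" "j < n" by auto
    have "(mat_adjoint U * U) $$ (i, j) =
        (\<Sum>k<n. cnj (ws ! i $ k) * ws ! j $ k) / complex_of_real (sqrt (N i) * sqrt (N j))"
      unfolding index_mult_mat_sum[OF mat_adjoint_carrier[OF U] U ij] sum_divide_distrib
      by (intro sum.cong) (simp_all add: mat_adjoint_index[OF U] ij, simp add: U_def ij)
    also have "\<dots> = (1\<^sub>m n :: complex mat) $$ (i, j)"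
      using Npos[OF ij(1)] by (auto simp: orth[OF ij] ij simp flip: of_real_mult)
    finally show "(mat_adjoint U * U) $$ (i, j) = 1\<^sub>m n $$ (i, j)" .
  qed (use U mat_adjoint_carrier[OF U] in auto)
  moreover have "U $$ (i, 0) = v $ i" if "i < n" for i
    using that n0 unit by (simp add: U_def ws0 N_def)
  ultimately show ?thesis using U that by blast
qed

text \<open>Squared row norms are the diagonal entries of \<open>A * mat_adjoint A\<close>, and this
  matrix does not change when \<open>A\<close> is replaced by \<open>A * U\<close>.\<close>

lemma row_norm_mult_unitary:
  assumes A: "A \<in> carrier_mat m n" and U: "U \<in> carrier_mat n n" "mat_adjoint U * U = 1\<^sub>m n"
    and i: "i < m"
  shows "(\<Sum>j<n. (cmod ((A * U) $$ (i, j)))\<^sup>2) = (\<Sum>j<n. (cmod (A $$ (i, j)))\<^sup>2)"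
proof -
  note a = mat_adjoint_carrier[OF A] mat_adjoint_carrier[OF U(1)]
  have norm: "complex_of_real (\<Sum>j<n. (cmod (C $$ (i, j)))\<^sup>2) = (C * mat_adjoint C) $$ (i, i)"
    if C: "C \<in> carrier_mat m n" for C
    using gram_diag[OF mat_adjoint_carrier[OF C] i] unfolding mat_adjoint_adjoint[OF C]
    by (simp add: mat_adjoint_index[OF C _ i] del: index_mult_mat)
  have "(A * U) * mat_adjoint (A * U) = A * (U * mat_adjoint U) * mat_adjoint A"
    using A U(1) a by (simp add: mat_adjoint_mult[OF A U(1)] assoc_mult_mat[of _ _ n _ n _ m]
        assoc_mult_mat[of _ m n _ n _ n] mult_carrier_mat[of _ n n])
  \<comment> \<open>For square matrices the left inverse \<open>mat_adjoint U\<close> of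
    \<open>U\<close> is also a right inverse.\<close>
  also have "\<dots> = A * mat_adjoint A"
    using mat_mult_left_right_inverse[OF a(2) U] A by simp
  finally have "complex_of_real (\<Sum>j<n. (cmod ((A * U) $$ (i, j)))\<^sup>2) =
      complex_of_real (\<Sum>j<n. (cmod (A $$ (i, j)))\<^sup>2)"
    unfolding norm[OF A] using norm[OF mult_carrier_mat[OF A U(1)]] by simp
  then show ?thesis by (simp only: of_real_eq_iff)
qed

lemma cmod_det_unitary:
  assumes U: "U \<in> carrier_mat n n" "mat_adjoint U * U = 1\<^sub>m n"
  shows "cmod (det U) = 1"
proof -
  have "complex_of_real ((cmod (det U))\<^sup>2) = 1" using cmod_det_sq[OF U(1)] U(2) by simp
  then have "(cmod (det U))\<^sup>2 = 1\<^sup>2" by (simp only: of_real_eq_1_iff) simp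
  then show ?thesis by (simp only: power2_eq_iff_nonneg[OF norm_ge_zero zero_le_one])
qed

section \<open>Determinant bounds that involve the image of one unit vector\<close>

lemma det_mat_diag: "det (mat_diag n f) = (\<Prod>i<n. f i)"
proof -
  have "upper_triangular (mat_diag n f)" by (auto simp: mat_diag_def)
  from det_upper_triangular[OF this mat_diag_dim] show ?thesis
    by (simp add: prod_list_diag_prod atLeast0LessThan mat_diag_def)
qed

text \<open>A plain AM-GM bound does not see \<open>v\<close>. Rotating \<open>v\<close> into column
  0 and reweighting that column brings the norm of \<open>A *\<^sub>v v\<close> into the
  estimate.\<close>

lemma cmod_det_sq_le_normalized_rows:
  assumes A: "A \<in> carrier_mat n n" and n: "n \<ge> 2"
    and rows: "\<And>i. i < n \<Longrightarrow> (\<Sum>j<n. (cmod (A $$ (i, j)))\<^sup>2) = 1"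
    and v: "v \<in> carrier_vec n" "(\<Sum>i<n. (cmod (v $ i))\<^sup>2) = 1" and det: "det A \<noteq> 0"
  shows "(cmod (det A))\<^sup>2 \<le> (real n / (real n - 1)) ^ (n - 1) * (\<Sum>i<n. (cmod ((A *\<^sub>v v) $ i))\<^sup>2)"
    (is "_ \<le> _ * ?q")
proof -
  obtain U where U: "U \<in> carrier_mat n n" "mat_adjoint U * U = 1\<^sub>m n"
    and Uv: "\<And>i. i < n \<Longrightarrow> U $$ (i, 0) = v $ i"
    using unitary_completion[OF v] by blast
  define C where "C = A * U"
  have C: "C \<in> carrier_mat n n" using A U by (simp add: C_def)
  have detC: "cmod (det C) = cmod (det A)"
    by (simp add: C_def det_mult[OF A U(1)] norm_mult cmod_det_unitary[OF U])
  have C0: "C $$ (i, 0) = (A *\<^sub>v v) $ i" if i: "i < n" for i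
  proof -
    have "C $$ (i, 0) = (\<Sum>l<n. A $$ (i, l) * U $$ (l, 0))"
      unfolding C_def by (rule index_mult_mat_sum[OF A U(1) i]) (use n in simp)
    also have "\<dots> = (A *\<^sub>v v) $ i"
      using A v i by (simp add: scalar_prod_def atLeast0LessThan Uv)
    finally show ?thesis .
  qed
  have q0: "0 \<le> ?q" by (intro sum_nonneg) auto
  \<comment> \<open>The weight \<open>s\<close> below divides by \<open>?q\<close>; if
    \<open>?q\<close> were 0, column 0 of \<open>C\<close> would vanish and \<open>C\<close> would
    be singular.\<close>
  have "?q \<noteq> 0"
  proof
    assume "?q = 0"
    then have "C $$ (i, 0) = 0" if "i < n" for i using that by (simp add: sum_nonneg_eq_0_iff C0)
    then have "det C = 0" using n by (subst laplace_expansion_column[OF C, of 0]) auto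
    with det detC show False by simp
  qed
  with q0 have q: "0 < ?q" by simp
  have n1: "real n - 1 > 0" using n by simp
  \<comment> \<open>\<open>s\<close> is the square of the factor put on column 0. AM-GM will give
    the bound ((n + s ?q) / n)^n / s for the squared determinant, and s ?q = n / (n - 1) minimises
    it over s > 0.\<close>
  define s where "s = real n / ((real n - 1) * ?q)"
  have s: "0 < s" using q n1 n by (simp add: s_def)
  define d where "d j = (if j = 0 then complex_of_real (sqrt s) else 1)" for j :: nat
  define X where "X = C * mat_diag n d"
  have X: "X \<in> carrier_mat n n" using C by (simp add: X_def)
  have Xij: "(cmod (X $$ (i, j)))\<^sup>2 = (cmod (C $$ (i, j)))\<^sup>2 * (if j = 0 then s else 1)"
    if "i < n" "j < n" for i j
    using that s by (simp add: X_def mat_diag_mult_right[OF C] d_def norm_mult power_mult_distrib)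
  have "(\<Prod>i<n. d i) = complex_of_real (sqrt s)"
    using n by (simp add: d_def prod.delta)
  then have detX: "(cmod (det X))\<^sup>2 = s * (cmod (det A))\<^sup>2"
    using s by (simp add: X_def det_mult[OF C mat_diag_dim] det_mat_diag norm_mult detC power_mult_distrib)
  have "(\<Sum>i<n. \<Sum>j<n. (cmod (X $$ (i, j)))\<^sup>2) \<le>
      (\<Sum>i<n. (\<Sum>j<n. (cmod (C $$ (i, j)))\<^sup>2) + s * (cmod (C $$ (i, 0)))\<^sup>2)"
  proof (rule sum_mono)
    fix i assume "i \<in> {..<n}"
    then have i: "i < n" by simp
    \<comment> \<open>Column 0 is counted twice on the right, once unscaled and once scaled; this
      loss keeps the total at n + s ?q.\<close>
    have "(\<Sum>j<n. (cmod (X $$ (i, j)))\<^sup>2) \<le>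
        (\<Sum>j<n. (cmod (C $$ (i, j)))\<^sup>2 + (if j = 0 then s * (cmod (C $$ (i, j)))\<^sup>2 else 0))"
      by (rule sum_mono) (simp add: Xij i)
    also have "\<dots> = (\<Sum>j<n. (cmod (C $$ (i, j)))\<^sup>2) + s * (cmod (C $$ (i, 0)))\<^sup>2"
      using n by (simp add: sum.distrib)
    finally show "(\<Sum>j<n. (cmod (X $$ (i, j)))\<^sup>2) \<le> (\<Sum>j<n. (cmod (C $$ (i, j)))\<^sup>2) + s * (cmod (C $$ (i, 0)))\<^sup>2" .
  qed
  also have "\<dots> = n + s * ?q"
    using rows row_norm_mult_unitary[OF A U] by (simp add: sum.distrib C0 C_def[symmetric] flip: sum_distrib_left)
  also have "s * ?q = real n / (real n - 1)" using q by (simp add: s_def)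
  also have "real n + real n / (real n - 1) = n * (real n / (real n - 1))"
    using n1 by (simp add: field_simps)
  finally have fro: "(\<Sum>i<n. \<Sum>j<n. (cmod (X $$ (i, j)))\<^sup>2) / n \<le> real n / (real n - 1)"
    using n by (simp add: divide_le_eq mult.commute)
  have "s * (cmod (det A))\<^sup>2 \<le> ((\<Sum>i<n. \<Sum>j<n. (cmod (X $$ (i, j)))\<^sup>2) / n) ^ n"
    using cmod_det_sq_le_frobenius[OF X] n detX by simp
  also have "\<dots> \<le> (real n / (real n - 1)) ^ n"
    by (intro power_mono fro divide_nonneg_nonneg sum_nonneg) auto
  \<comment> \<open>One of the \<open>n\<close> factors is written as s ?q, so that \<open>s\<close>
    cancels against the left-hand side.\<close>
  also have "\<dots> = (real n / (real n - 1)) ^ (n - 1) * ?q * s"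
  proof -
    have "(real n / (real n - 1)) ^ n = (real n / (real n - 1)) ^ (n - 1) * (real n / (real n - 1))"
      using n by (metis power_minus_mult less_le_trans zero_less_numeral)
    then show ?thesis by (simp only: mult.assoc mult.commute[of ?q] \<open>s * ?q = real n / (real n - 1)\<close>)
  qed
  finally show ?thesis using s by (simp add: mult.commute)
qed

text \<open>Dividing row \<open>i\<close> by \<open>r i\<close> reduces to unit rows: the
  determinant loses the product of the \<open>r i\<close>, and each coordinate of
  \<open>A *\<^sub>v v\<close> is divided by at least \<open>m\<close>.\<close>

lemma cmod_det_sq_le_scaled_rows:
  assumes A: "A \<in> carrier_mat n n" and n: "n \<ge> 2" and det: "det A \<noteq> 0"
    and rows: "\<And>i. i < n \<Longrightarrow> (\<Sum>j<n. (cmod (A $$ (i, j)))\<^sup>2) = (r i)\<^sup>2"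
    and m: "0 < m" "\<And>i. i < n \<Longrightarrow> m \<le> r i"
    and v: "v \<in> carrier_vec n" "(\<Sum>i<n. (cmod (v $ i))\<^sup>2) = 1"
  shows "(cmod (det A) * m)\<^sup>2 \<le>
    (real n / (real n - 1)) ^ (n - 1) * (\<Sum>i<n. (cmod ((A *\<^sub>v v) $ i))\<^sup>2) * (\<Prod>i<n. r i)\<^sup>2"
    (is "_ \<le> ?K * ?q * _")
proof -
  have rpos: "0 < r i" if "i < n" for i using m(1) m(2)[OF that] by linarith
  define d where "d i = complex_of_real (1 / r i)" for i
  define B where "B = mat_diag n d * A"
  have B: "B \<in> carrier_mat n n" unfolding B_def by (rule mult_carrier_mat[OF mat_diag_dim A])
  have Bij: "B $$ (i, j) = A $$ (i, j) / complex_of_real (r i)" if "i < n" "j < n" for i j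
    using that by (simp add: B_def mat_diag_mult_left[OF A] d_def)
  have "det B = (\<Prod>i<n. d i) * det A"
    by (simp add: B_def det_mult[OF mat_diag_dim A] det_mat_diag)
  moreover have "(\<Prod>i<n. d i) = complex_of_real (1 / (\<Prod>i<n. r i))"
    by (simp add: d_def prod_dividef)
  ultimately have detB: "det B = det A / complex_of_real (\<Prod>i<n. r i)"
    by (simp del: of_real_prod)
  have P: "0 < (\<Prod>i<n. r i)" using rpos by (intro prod_pos) auto
  have "(\<Sum>j<n. (cmod (B $$ (i, j)))\<^sup>2) = 1" if i: "i < n" for i
    using rows[OF i] rpos[OF i] by (simp add: Bij i norm_divide power_divide flip: sum_divide_distrib)
  moreover have "det B \<noteq> 0" using detB det less_imp_neq[OF P] by auto
  ultimately have "(cmod (det B))\<^sup>2 \<le> ?K * (\<Sum>i<n. (cmod ((B *\<^sub>v v) $ i))\<^sup>2)"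
    using cmod_det_sq_le_normalized_rows[OF B n _ v] by blast
  also have "\<dots> \<le> ?K * (\<Sum>i<n. (cmod ((A *\<^sub>v v) $ i))\<^sup>2 / m\<^sup>2)"
  proof (intro mult_left_mono sum_mono)
    fix i assume "i \<in> {..<n}"
    then have i: "i < n" by simp
    have "(B *\<^sub>v v) $ i = (\<Sum>j<n. B $$ (i, j) * v $ j)"
      using B v i by (simp add: scalar_prod_def atLeast0LessThan)
    also have "\<dots> = (\<Sum>j<n. A $$ (i, j) * v $ j) / complex_of_real (r i)"
      unfolding sum_divide_distrib by (intro sum.cong) (simp_all add: Bij i)
    also have "(\<Sum>j<n. A $$ (i, j) * v $ j) = (A *\<^sub>v v) $ i"
      using A v i by (simp add: scalar_prod_def atLeast0LessThan)
    finally have "(cmod ((B *\<^sub>v v) $ i))\<^sup>2 = (cmod ((A *\<^sub>v v) $ i))\<^sup>2 / (r i)\<^sup>2"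
      by (simp add: norm_divide power_divide)
    also have "\<dots> \<le> (cmod ((A *\<^sub>v v) $ i))\<^sup>2 / m\<^sup>2"
      using m rpos[OF i] i by (intro divide_left_mono power_mono mult_pos_pos) auto
    finally show "(cmod ((B *\<^sub>v v) $ i))\<^sup>2 \<le> (cmod ((A *\<^sub>v v) $ i))\<^sup>2 / m\<^sup>2" .
  qed (use n in auto)
  finally have "(cmod (det A))\<^sup>2 / (\<Prod>i<n. r i)\<^sup>2 \<le> ?K * ?q / m\<^sup>2"
    using P by (simp add: detB norm_divide power_divide flip: sum_divide_distrib del: of_real_prod)
  then have "(cmod (det A))\<^sup>2 / (\<Prod>i<n. r i)\<^sup>2 * ((\<Prod>i<n. r i)\<^sup>2 * m\<^sup>2) \<le>
      ?K * ?q / m\<^sup>2 * ((\<Prod>i<n. r i)\<^sup>2 * m\<^sup>2)"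
    by (rule mult_right_mono) simp
  \<comment> \<open>Cancellation rules that clear the denominators, with \<open>p\<close> the
    squared product of the \<open>r i\<close> and \<open>y\<close> the square of
    \<open>m\<close>.\<close>
  moreover have "x / p * (p * y) = x * y" "z / y * (p * y) = z * p" if "p \<noteq> 0" "y \<noteq> 0" for x y z p :: real
    using that by simp_all
  ultimately show ?thesis
    using less_imp_neq[OF P] m(1) by (simp only: power_mult_distrib) auto
qed

section \<open>Singular vectors and the bound by row norms\<close>

lemma gram_eigenvector_norm:
  assumes A: "A \<in> carrier_mat n n" and v: "v \<in> carrier_vec n"
    and ev: "(mat_adjoint A * A) *\<^sub>v v = complex_of_real (s\<^sup>2) \<cdot>\<^sub>v v"
  shows "(\<Sum>i<n. (cmod ((A *\<^sub>v v) $ i))\<^sup>2) = s\<^sup>2 * (\<Sum>i<n. (cmod (v $ i))\<^sup>2)"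
proof -
  note B = mat_adjoint_carrier[OF A]
  define w where "w = A *\<^sub>v v"
  have w: "w \<in> carrier_vec n" using A v by (simp add: w_def)
  have Bw: "mat_adjoint A *\<^sub>v w = complex_of_real (s\<^sup>2) \<cdot>\<^sub>v v"
    using ev assoc_mult_mat_vec[OF B A v] by (simp add: w_def)
  have wi: "w $ i = (\<Sum>j<n. A $$ (i, j) * v $ j)" if "i < n" for i
    using that A v by (simp add: w_def scalar_prod_def atLeast0LessThan)
  have vj: "(\<Sum>i<n. cnj (A $$ (i, j)) * w $ i) = complex_of_real (s\<^sup>2) * v $ j" if j: "j < n" for j
  proof -
    have "(\<Sum>i<n. cnj (A $$ (i, j)) * w $ i) = (mat_adjoint A *\<^sub>v w) $ j"
      using B w j by (simp add: scalar_prod_def atLeast0LessThan mat_adjoint_index[OF A])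
    then show ?thesis using v j by (simp add: Bw)
  qed
  \<comment> \<open>The adjoint moves \<open>A\<close> to the other side of the inner product: <A v,
    A v> = <A* A v, v>, written in coordinates.\<close>
  have "complex_of_real (\<Sum>i<n. (cmod (w $ i))\<^sup>2) = (\<Sum>i<n. \<Sum>j<n. cnj (v $ j) * (cnj (A $$ (i, j)) * w $ i))"
    unfolding of_real_sum complex_of_real_cmod_square
    by (intro sum.cong refl, subst (1) wi) (simp_all add: sum_distrib_right sum_distrib_left mult_ac)
  also have "\<dots> = (\<Sum>j<n. cnj (v $ j) * (complex_of_real (s\<^sup>2) * v $ j))"
    by (subst sum.swap) (simp add: vj flip: sum_distrib_left)
  also have "\<dots> = complex_of_real (s\<^sup>2 * (\<Sum>i<n. (cmod (v $ i))\<^sup>2))"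
    unfolding of_real_mult of_real_sum complex_of_real_cmod_square by (simp add: sum_distrib_left mult_ac)
  finally show ?thesis unfolding w_def by (simp only: of_real_eq_iff)
qed

lemma singular_value_unit_vector:
  assumes A: "A \<in> carrier_mat n n" and s: "s \<in> singular_values A"
  obtains v where "v \<in> carrier_vec n" "(\<Sum>i<n. (cmod (v $ i))\<^sup>2) = 1"
    "(\<Sum>i<n. (cmod ((A *\<^sub>v v) $ i))\<^sup>2) = s\<^sup>2"
proof -
  note B = mat_adjoint_carrier[OF A]
  obtain u where u: "u \<in> carrier_vec n" "u \<noteq> 0\<^sub>v n"
    and Gu: "(mat_adjoint A * A) *\<^sub>v u = complex_of_real (s\<^sup>2) \<cdot>\<^sub>v u"
    using s B by (auto simp: singular_values_def eigenvalue_def eigenvector_def)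
  define N where "N = (\<Sum>i<n. (cmod (u $ i))\<^sup>2)"
  have "N \<noteq> 0"
  proof
    assume "N = 0"
    then have "u = 0\<^sub>v n" using u(1) by (intro eq_vecI) (auto simp: N_def sum_nonneg_eq_0_iff)
    with u(2) show False ..
  qed
  moreover have "0 \<le> N" by (simp add: N_def sum_nonneg)
  ultimately have N: "0 < N" by simp
  define v where "v = complex_of_real (1 / sqrt N) \<cdot>\<^sub>v u"
  have scale: "(\<Sum>i<n. (cmod ((complex_of_real (1 / sqrt N) \<cdot>\<^sub>v x) $ i))\<^sup>2) = (\<Sum>i<n. (cmod (x $ i))\<^sup>2) / N"
    if "x \<in> carrier_vec n" for x
    using that N by (simp add: norm_divide power_divide flip: sum_divide_distrib)
  show ?thesis
  proof
    show "v \<in> carrier_vec n" using u by (simp add: v_def)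
    show "(\<Sum>i<n. (cmod (v $ i))\<^sup>2) = 1"
      unfolding v_def scale[OF u(1)] using N by (simp add: N_def)
    have "A *\<^sub>v v = complex_of_real (1 / sqrt N) \<cdot>\<^sub>v (A *\<^sub>v u)"
      unfolding v_def by (rule mult_mat_vec[OF A u(1)])
    then show "(\<Sum>i<n. (cmod ((A *\<^sub>v v) $ i))\<^sup>2) = s\<^sup>2"
      using scale[OF mult_mat_vec_carrier[OF A u(1)]] gram_eigenvector_norm[OF A u(1) Gu] N
      by (simp add: N_def)
  qed
qed

text \<open>If \<open>v\<close> is an eigenvector of the Gram matrix of \<open>A\<close>, then
  \<open>A *\<^sub>v v\<close> is one of \<open>A * mat_adjoint A\<close> for the same eigenvalue;
  invertibility keeps it nonzero.\<close>

lemma singular_values_adjoint: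
  assumes A: "A \<in> carrier_mat n n" and det: "det A \<noteq> 0" and s: "s \<in> singular_values A"
  shows "s \<in> singular_values (mat_adjoint A)"
proof -
  note B = mat_adjoint_carrier[OF A]
  obtain v where v: "v \<in> carrier_vec n" "v \<noteq> 0\<^sub>v n"
    and Gv: "(mat_adjoint A * A) *\<^sub>v v = complex_of_real (s\<^sup>2) \<cdot>\<^sub>v v"
    using s B by (auto simp: singular_values_def eigenvalue_def eigenvector_def)
  have w: "A *\<^sub>v v \<in> carrier_vec n" using A v by simp
  have "A *\<^sub>v v \<noteq> 0\<^sub>v n" using det_0_iff_vec_prod_zero[OF A] det v by blast
  moreover have "(A * mat_adjoint A) *\<^sub>v (A *\<^sub>v v) = complex_of_real (s\<^sup>2) \<cdot>\<^sub>v (A *\<^sub>v v)"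
    using Gv assoc_mult_mat_vec[OF A B w] assoc_mult_mat_vec[OF B A v(1)] mult_mat_vec[OF A v(1)]
    by simp
  ultimately show ?thesis
    using s A w unfolding singular_values_def eigenvalue_def eigenvector_def mat_adjoint_adjoint[OF A]
    by auto
qed

text \<open>Stated for an arbitrary positive singular value, so that it applies to the adjoint with
  the same \<open>s\<close> without identifying the smallest singular value there.\<close>

lemma cmod_det_le_row_norms:
  assumes A: "A \<in> carrier_mat n n" and n: "n \<ge> 2" and det: "det A \<noteq> 0"
    and r: "\<And>i. i < n \<Longrightarrow> r i = L2_set (\<lambda>j. cmod (A $$ (i, j))) {..<n}"
    and s: "s \<in> singular_values A" "0 < s"
  shows "cmod (det A) / s \<le>
    (real n / (real n - 1)) powr ((real n - 1) / 2) * ((\<Prod>i<n. r i) / Min (r ` {..<n}))"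
    (is "_ \<le> ?K * (?P / ?m)")
proof -
  have rpos: "0 < r i" if i: "i < n" for i
  proof -
    have "r i \<noteq> 0"
    proof
      assume "r i = 0"
      then have "\<forall>j<n. A $$ (i, j) = 0" using r[OF i] by (simp add: L2_set_eq_0_iff)
      then have "det A = 0" using laplace_expansion_row[OF A i] by simp
      with det show False ..
    qed
    moreover have "0 \<le> r i" using r[OF i] by (simp add: L2_set_nonneg)
    ultimately show ?thesis by simp
  qed
  have P: "0 < ?P" using rpos by (intro prod_pos) auto
  have r2: "(\<Sum>j<n. (cmod (A $$ (i, j)))\<^sup>2) = (r i)\<^sup>2" if "i < n" for i
    using r[OF that] by (simp add: L2_set_def sum_nonneg)
  have fin: "finite (r ` {..<n})" "r ` {..<n} \<noteq> {}" using n by (auto simp: lessThan_empty_iff)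
  have m: "0 < ?m" using rpos Min_in[OF fin] by auto
  have mr: "?m \<le> r i" if "i < n" for i using fin(1) that by auto
  obtain v where v: "v \<in> carrier_vec n" "(\<Sum>i<n. (cmod (v $ i))\<^sup>2) = 1"
    and Av: "(\<Sum>i<n. (cmod ((A *\<^sub>v v) $ i))\<^sup>2) = s\<^sup>2"
    using singular_value_unit_vector[OF A s(1)] .
  \<comment> \<open>Squaring doubles the exponent (n - 1) / 2, so the real power becomes the natural
    power of the squared estimate.\<close>
  have "(?K)\<^sup>2 = (real n / (real n - 1)) powr real (n - 1)"
    using n by (simp add: power2_eq_square of_nat_diff flip: powr_add)
  also have "\<dots> = (real n / (real n - 1)) ^ (n - 1)"
    using n by (intro powr_realpow) simp
  finally have "(cmod (det A) * ?m)\<^sup>2 \<le> (?K * s * ?P)\<^sup>2"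
    using cmod_det_sq_le_scaled_rows[OF A n det r2 m mr v] by (simp add: Av power_mult_distrib)
  then have "cmod (det A) * ?m \<le> ?K * s * ?P"
    by (rule power2_le_imp_le) (use s P in auto)
  then show ?thesis using s(2) m by (simp add: field_simps)
qed

section \<open>Application to the Vandermonde matrix\<close>

theorem theorem6:
  fixes f :: "int poly" and n :: nat and as :: "complex list"
    and M :: "complex mat" and r c :: "nat \<Rightarrow> real"
  assumes "lead_coeff f = 1" and "irreducible f" and "degree f = n" and "n \<ge> 2"
    and "root_enumeration f as" and "M = vandermonde_mat as"
    and "\<And>i. i < n \<Longrightarrow> r i = L2_set (\<lambda>j. cmod (M $$ (i, j))) {..<n}"
    and "\<And>j. j < n \<Longrightarrow> c j = L2_set (\<lambda>i. cmod (M $$ (i, j))) {..<n}"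
  shows "spectral_distortion f \<le>
    (real n / (real n - 1)) powr ((real n - 1) / 2) * cmod (det M) powr ((1 - real n) / real n) *
    min ((\<Prod>i<n. r i) / Min (r ` {..<n})) ((\<Prod>j<n. c j) / Min (c ` {..<n}))"
    (is "_ \<le> ?K * ?D * min ?R ?C")
proof -
  have SD: "spectral_distortion f = cmod (det M) powr (1 / real n) / sigma_min M"
    using spectral_distortion_eq[OF assms(5)] assms(3,6) by simp
  have M: "M \<in> carrier_mat n n"
    using vandermonde_mat_carrier[of as] root_enumeration_length[OF assms(5)] assms(3,6) by simp
  show ?thesis
  proof (cases "det M = 0")
    case True
    \<comment> \<open>\<open>0 powr x\<close> is 0 for every real \<open>x\<close>, also for the
      negative exponent on the right, so both sides are 0.\<close>
    then show ?thesis by (simp add: SD)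
  next
    case False
    let ?s = "sigma_min M"
    have s: "?s \<in> singular_values M"
      using Min_in[OF singular_values_finite[OF M] singular_values_nonempty[OF M]] assms(4)
      by (simp add: sigma_min_def)
    \<comment> \<open>A zero singular value would give the Gram matrix a kernel vector, while its
      determinant is the square of \<open>cmod (det M)\<close>.\<close>
    have "?s \<noteq> 0"
    proof
      assume "?s = 0"
      then have "eigenvalue (mat_adjoint M * M) 0" using s by (simp add: singular_values_def)
      then obtain v where v: "v \<in> carrier_vec n" "v \<noteq> 0\<^sub>v n" "(mat_adjoint M * M) *\<^sub>v v = 0 \<cdot>\<^sub>v v"
        using M mat_adjoint_carrier[OF M]
        by (auto simp: eigenvalue_def eigenvector_def simp del: assoc_mult_mat_vec)
      moreover have "0 \<cdot>\<^sub>v v = 0\<^sub>v n" using v(1) by (intro eq_vecI) auto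
      ultimately have "det (mat_adjoint M * M) = 0"
        using det_0_iff_vec_prod_zero[OF mult_carrier_mat[OF mat_adjoint_carrier[OF M] M]] by metis
      with False cmod_det_sq[OF M] show False by simp
    qed
    with s have s0: "0 < ?s" by (auto simp: singular_values_def)
    note M' = mat_adjoint_carrier[OF M]
    have det': "det (mat_adjoint M) \<noteq> 0" using cmod_det_adjoint[OF M] False by auto
    \<comment> \<open>Column norms of \<open>M\<close> are row norms of its adjoint, so the row
      bound yields the column bound.\<close>
    have c': "c j = L2_set (\<lambda>i. cmod (mat_adjoint M $$ (j, i))) {..<n}" if "j < n" for j
      unfolding assms(8)[OF that] using that by (intro L2_set_cong) (simp_all add: mat_adjoint_index[OF M])
    have "cmod (det M) / ?s \<le> ?K * ?R"
      by (rule cmod_det_le_row_norms[OF M assms(4) False assms(7) s s0])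
    moreover have "cmod (det M) / ?s \<le> ?K * ?C"
      using cmod_det_le_row_norms[OF M' assms(4) det' c' singular_values_adjoint[OF M False s] s0]
      by (simp add: cmod_det_adjoint[OF M])
    ultimately have "cmod (det M) / ?s \<le> ?K * min ?R ?C" by (simp add: min_def)
    then have "?D * (cmod (det M) / ?s) \<le> ?D * (?K * min ?R ?C)" by (rule mult_left_mono) simp
    \<comment> \<open>Since 1 / n = (1 - n) / n + 1, multiplying by \<open>?D\<close> turns
      \<open>cmod (det M) / ?s\<close> into the spectral distortion.\<close>
    moreover have "cmod (det M) powr (1 / real n) = ?D * cmod (det M)"
    proof -
      have "1 / real n = (1 - real n) / real n + 1" using assms(4) by (simp add: field_simps)
      then have "cmod (det M) powr (1 / real n) = cmod (det M) powr ((1 - real n) / real n + 1)" by simp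
      also have "\<dots> = ?D * cmod (det M)" using False by (subst powr_add) simp
      finally show ?thesis .
    qed
    ultimately show ?thesis by (simp add: SD mult_ac)
  qed
qed

end
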